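(* For every positive integer $n$, let $G_n$ be the set of words in $\{1,2\}^*_n$ with no two consecutive $2$'s, and let $$H=\{\omega=1^{m_0}2^{n_0}1^{m_1}2^{n_1}\cdots1^{m_d}2^{n_d} \mid m_0=m_d-1,\ m_i=m_{d-i}\text{ for }1\le i\le d-1\}.$$ Then $\Phi_2(G_n)=\Phi_1^{-1}(G_n)=\Gamma(G_n)$, and $\Phi_1^{-1}(\omega)=\Phi_2(\omega)$ for every $\omega\in H$.
   Context: $\{1,2\}^*_n$ is the set of words of length $n$ on $\{1,2\}$; $a^r$ denotes $r$ consecutive copies of the letter $a$. Every binary word with $d$ descents is written uniquely as $\omega=1^{m_0}2^{n_0}1^{m_1}2^{n_1}\cdots1^{m_d}2^{n_d}$ with $m_0,n_d\ge0$, $m_i>0$ for $1\le i\le d$ and $n_j>0$ for $0\le j\le d-1$ (this is the form used in the definition of $H$). On binary words, Foata's first fundamental transformation $\Phi_1$ (which coincides with Han's bijection there) satisfies $$\Phi_1^{-1}(\omega)=1^{m_0}21^{m_1-1}2\cdots21^{m_d-1}2^{n_0-1}12^{n_1-1}\cdots2^{n_{d-1}-1}12^{n_d},$$ and Foata's second fundamental transformation $\Phi_2$ satisfies $$\Phi_2(\omega)=1^{m_d-1}21^{m_{d-1}-1}2\cdots1^{m_1-1}21^{m_0}2^{n_0-1}12^{n_1-1}1\cdots2^{n_{d-1}-1}12^{n_d}.$$ Steingrímsson's map $\phi$: for a permutation $\pi=\pi_1\cdots\pi_n$ of $[n]$ set $\pi_0=0$ and define $\phi(\pi)=f(1)\cdots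 f(n)$ by, for each $k=1,\dots,n$: (1) if some $m$ with $k<m\le n$ has $\pi_m<\pi_k$, set $f(\pi_{k+1})=\pi_k$; (2) if $\pi_k<\pi_m$ for all $k<m\le n$, set $f(\pi_{j+1})=\pi_k$ with $j$ the largest index in $\{0,\dots,k-1\}$ having $\pi_j<\pi_k$. The standardization of $\omega=a_1\cdots a_n$ is $\beta_\omega(1)\cdots\beta_\omega(n)$ with $\beta_\omega(i)=\#\{j:a_j<a_i\}+\#\{j\le i:a_j=a_i\}$. $\Gamma(\omega)=a_{j_1}\cdots a_{j_n}$, where $\phi(\beta_\omega(1)\cdots\beta_\omega(n))=f(1)\cdots f(n)$ and $j_i$ is the unique index with $\beta_\omega(j_i)=f(i)$. For a map $\Psi$ and set $S$, $\Psi(S)=\{\Psi(\omega):\omega\in S\}$. *)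

theory Defs
  imports Main
begin

section \<open>Foata's first fundamental transformation\<close>

text \<open>A word is cut at its weak left-to-right maxima, so that in each factor the first letter is
  strictly larger than all the other ones and the first letters are weakly increasing.\<close>

function dominated_factors :: "'a::linorder list \<Rightarrow> 'a list list" where
  "dominated_factors [] = []"
| "dominated_factors (x # xs) =
     (x # takeWhile (\<lambda>y. y < x) xs) # dominated_factors (dropWhile (\<lambda>y. y < x) xs)"
  by pat_completeness auto
termination
  by (relation "measure length") (auto simp: less_Suc_eq_le length_dropWhile_le)

text \<open>A factor \<open>x\<^sub>1\<dots>x\<^sub>r\<close> is the circuit with top row \<open>x\<^sub>2\<dots>x\<^sub>r x\<^sub>1\<close> and
  bottom row \<open>x\<^sub>1\<dots>x\<^sub>r\<close>. In the product of the circuits, columns with distinct top letters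
  commute; the columns are therefore sorted stably by top letter, and \<open>\<Phi>\<^sub>1\<^sup>-\<^sup>1\<close> reads off the
  bottom row. (\<open>sort_key\<close> is stable.)\<close>

definition circuit :: "'a list \<Rightarrow> ('a \<times> 'a) list" where
  "circuit u = zip (rotate1 u) u"

definition foata1_inv :: "'a::linorder list \<Rightarrow> 'a list" where
  "foata1_inv w = map snd (sort_key fst (concat (map circuit (dominated_factors w))))"


section \<open>Foata's second fundamental transformation\<close>

text \<open>\<open>cut_after P v\<close> cuts \<open>v\<close> after each letter satisfying \<open>P\<close>.\<close>

fun cut_after :: "('a \<Rightarrow> bool) \<Rightarrow> 'a list \<Rightarrow> 'a list list" where
  "cut_after P [] = []"
| "cut_after P (x # xs) =
     (if P x then [x] # cut_after P xs
      else (case cut_after P xs of [] \<Rightarrow> [[x]] | b # bs \<Rightarrow> (x # b) # bs))"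

definition last_to_front :: "'a list \<Rightarrow> 'a list" where
  "last_to_front b = last b # butlast b"

definition foata2_step :: "'a::linorder list \<Rightarrow> 'a \<Rightarrow> 'a list" where
  "foata2_step v a =
     concat (map last_to_front
       (cut_after (if v \<noteq> [] \<and> last v \<le> a then (\<lambda>x. x \<le> a) else (\<lambda>x. a < x)) v)) @ [a]"

definition foata2 :: "'a::linorder list \<Rightarrow> 'a list" where
  "foata2 w = foldl foata2_step [] w"


section \<open>Steingrimsson's map and \<open>\<Gamma>\<close>\<close>

text \<open>A permutation of \<open>[n]\<close> is the list \<open>[\<pi>\<^sub>1, \<dots>, \<pi>\<^sub>n]\<close>; \<open>pi_at\<close> indexes it from 1 and
  includes the convention \<open>\<pi>\<^sub>0 = 0\<close>.\<close>

definition pi_at :: "nat list \<Rightarrow> nat \<Rightarrow> nat" where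
  "pi_at p k = (0 # p) ! k"

text \<open>\<open>phi_arg p k\<close> is the argument at which \<open>f\<close> takes the value \<open>\<pi>\<^sub>k\<close>. For a permutation,
  \<open>k \<mapsto> phi_arg p k\<close> is a bijection of \<open>[n]\<close>, so the description in \<open>phi\<close> is a proper one.\<close>

definition phi_arg :: "nat list \<Rightarrow> nat \<Rightarrow> nat" where
  "phi_arg p k =
     (if \<exists>m. k < m \<and> m \<le> length p \<and> pi_at p m < pi_at p k
      then pi_at p (k + 1)
      else pi_at p (Max {j. j < k \<and> pi_at p j < pi_at p k} + 1))"

definition phi :: "nat list \<Rightarrow> nat list" where
  "phi p = map (\<lambda>i. pi_at p (THE k. 1 \<le> k \<and> k \<le> length p \<and> phi_arg p k = i))
     [1..<Suc (length p)]"

text \<open>Positions in words are counted from 0; the values of the standardization lie in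
  \<open>{1..length w}\<close>.\<close>

definition standardization :: "'a::linorder list \<Rightarrow> nat list" where
  "standardization w =
     map (\<lambda>i. card {j. j < length w \<and> w ! j < w ! i} + card {j. j \<le> i \<and> w ! j = w ! i})
       [0..<length w]"

definition Gamma :: "'a::linorder list \<Rightarrow> 'a list" where
  "Gamma w =
     map (\<lambda>i. w ! (THE j. j < length w \<and> standardization w ! j = phi (standardization w) ! i))
       [0..<length w]"


section \<open>The sets of words\<close>

definition G :: "nat \<Rightarrow> nat list set" where
  "G n = {w. length w = n \<and> set w \<subseteq> {1, 2} \<and>
             (\<forall>i. Suc i < n \<longrightarrow> \<not> (w ! i = 2 \<and> w ! Suc i = 2))}"

text \<open>\<open>run_word d m n\<close> is \<open>1\<^bsup>m\<^sub>0\<^esup>2\<^bsup>n\<^sub>0\<^esup>\<dots>1\<^bsup>m\<^sub>d\<^esup>2\<^bsup>n\<^sub>d\<^esup>\<close>.\<close>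

definition run_word :: "nat \<Rightarrow> (nat \<Rightarrow> nat) \<Rightarrow> (nat \<Rightarrow> nat) \<Rightarrow> nat list" where
  "run_word d m n = concat (map (\<lambda>i. replicate (m i) 1 @ replicate (n i) 2) [0..<Suc d])"

definition run_exponents :: "nat \<Rightarrow> (nat \<Rightarrow> nat) \<Rightarrow> (nat \<Rightarrow> nat) \<Rightarrow> bool" where
  "run_exponents d m n \<longleftrightarrow> (\<forall>i. 1 \<le> i \<and> i \<le> d \<longrightarrow> m i > 0) \<and> (\<forall>j<d. n j > 0)"

text \<open>The equation \<open>m\<^sub>0 = m\<^sub>d - 1\<close> is stated in the integers; truncated subtraction would wrongly
  admit the words \<open>2\<^sup>k\<close> (\<open>d = 0\<close>, \<open>m\<^sub>0 = 0\<close>).\<close>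

definition H :: "nat list set" where
  "H = {run_word d m n | d m n. run_exponents d m n \<and>
          int (m 0) = int (m d) - 1 \<and> (\<forall>i. 1 \<le> i \<and> i \<le> d - 1 \<longrightarrow> m i = m (d - i))}"


section \<open>The closed forms of Foata's transformations on binary words\<close>

lemma run_word_0: "run_word 0 m n = replicate (m 0) 1 @ replicate (n 0) 2"
  by (simp add: run_word_def)

lemma run_word_Suc:
  "run_word (Suc d) m n = run_word d m n @ replicate (m (Suc d)) 1 @ replicate (n (Suc d)) 2"
  by (simp add: run_word_def)

lemma rotate_blocks:
  assumes "P c" and "\<And>x. x \<in> set u \<Longrightarrow> P x \<Longrightarrow> x = c"
  shows "concat (map last_to_front (cut_after P (u @ [c]))) = c # u"
  using assms(2)
proof (induction u)
  case Nil
  then show ?case using assms(1) by (simp add: last_to_front_def)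
next
  case (Cons x u)
  have IH: "concat (map last_to_front (cut_after P (u @ [c]))) = c # u"
    using Cons by simp
  show ?case
  proof (cases "P x")
    case True
    have "last_to_front [x] = [x]" by (simp add: last_to_front_def)
    then show ?thesis using True IH Cons.prems[of x] by simp
  next
    case False
    have ne: "cut_after Q v = b # bs \<Longrightarrow> b \<noteq> []" for Q v b bs
      by (cases v) (auto split: if_splits list.splits)
    have "cut_after P (u @ [c]) \<noteq> []" using IH by auto
    then obtain b bs where b: "cut_after P (u @ [c]) = b # bs" by (cases "cut_after P (u @ [c])") auto
    moreover have "last_to_front (x # b) = last b # x # butlast b"
      "last_to_front b = last b # butlast b"
      using ne[OF b] by (simp_all add: last_to_front_def)
    ultimately show ?thesis using IH False by auto
  qed
qed

lemma foata2_step_1: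
  assumes "set u \<subseteq> {1, 2}" and "c \<in> {1, 2}"
  shows "foata2_step (u @ [c]) (1::nat) = c # u @ [1]"
proof -
  have "concat (map last_to_front (cut_after (\<lambda>x. x \<le> 1) (u @ [c]))) = c # u" if "c = 1"
    by (rule rotate_blocks) (use assms that in auto)
  moreover have "concat (map last_to_front (cut_after (\<lambda>x. 1 < x) (u @ [c]))) = c # u" if "c = 2"
    by (rule rotate_blocks) (use assms that in auto)
  ultimately show ?thesis using assms(2) unfolding foata2_step_def by force
qed

lemma foata2_step_2:
  assumes "set v \<subseteq> {1, 2}"
  shows "foata2_step v (2::nat) = v @ [2]"
proof -
  have *: "set u \<subseteq> {1,2} \<Longrightarrow> concat (map last_to_front (cut_after (\<lambda>x. x \<le> 2) u)) = u"
    for u :: "nat list"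
    by (induction u) (auto simp: last_to_front_def)
  have "v = [] \<or> last v \<in> {1, 2}" using assms by (metis last_in_set subsetD)
  then show ?thesis using *[OF assms] by (auto simp: foata2_step_def)
qed

lemma foata2_append: "foata2 (u @ v) = foldl foata2_step (foata2 u) v"
  by (simp add: foata2_def)

lemma foldl_foata2_step_2:
  "set v \<subseteq> {1, 2} \<Longrightarrow> foldl foata2_step v (replicate k (2::nat)) = v @ replicate k 2"
  by (induction k arbitrary: v) (simp_all add: foata2_step_2)

lemma foldl_foata2_step_1_1:
  "set u \<subseteq> {1, 2} \<Longrightarrow>
     foldl foata2_step (u @ [1]) (replicate k (1::nat)) = replicate k 1 @ u @ [1]"
proof (induction k arbitrary: u)
  case (Suc k)
  then show ?case
    using foata2_step_1[of u 1] Suc.IH[of "1 # u"]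
    by (simp add: replicate_app_Cons_same)
qed simp

lemma foldl_foata2_step_1_2:
  assumes "set u \<subseteq> {1, 2}"
  shows "foldl foata2_step (u @ [2]) (replicate (Suc k) (1::nat)) = replicate k 1 @ 2 # u @ [1]"
  using assms foata2_step_1[of u 2] foldl_foata2_step_1_1[of "2 # u" k] by simp

text \<open>\<open>2\<^bsup>n\<^sub>0 - 1\<^esup>12\<^bsup>n\<^sub>1 - 1\<^esup>1\<dots>2\<^bsup>n\<^sub>d\<^sub>-\<^sub>1 - 1\<^esup>1\<close>\<close>

definition tail_part :: "nat \<Rightarrow> (nat \<Rightarrow> nat) \<Rightarrow> nat list" where
  "tail_part d n = concat (map (\<lambda>j. replicate (n j - 1) 2 @ [1]) [0..<d])"

theorem foata2_run_word:
  assumes "run_exponents d m n"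
  shows "foata2 (run_word d m n) =
    concat (map (\<lambda>i. replicate (m i - 1) 1 @ [2]) (rev [1..<Suc d])) @ replicate (m 0) 1
      @ tail_part d n @ replicate (n d) 2"
  using assms
proof (induction d)
  case 0
  have ones: "foldl foata2_step [] (replicate k (1::nat)) = replicate k 1" for k
  proof (cases k)
    case (Suc l)
    then show ?thesis
      using foldl_foata2_step_1_1[of "[]" l]
      by (simp add: foata2_step_def replicate_append_same)
  qed simp
  have "set (replicate (m 0) (1::nat)) \<subseteq> {1, 2}" by auto
  from foldl_foata2_step_2[OF this, of "n 0"] ones[of "m 0"] show ?case
    by (simp add: run_word_0 tail_part_def foata2_def)
next
  case (Suc d)
  let ?A = "concat (map (\<lambda>i. replicate (m i - 1) 1 @ [2]) (rev [1..<Suc d])) :: nat list"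
  have ex: "run_exponents d m n" "n d > 0" "m (Suc d) > 0"
    using Suc.prems by (auto simp: run_exponents_def)
  let ?u = "?A @ replicate (m 0) 1 @ tail_part d n @ replicate (n d - 1) 2"
  have u: "set ?u \<subseteq> {1, 2}" by (auto simp: tail_part_def)
  have "replicate (n d) (2::nat) = replicate (n d - 1) 2 @ [2]"
    using ex(2) by (metis Suc_diff_1 replicate_Suc replicate_append_same)
  then have IH: "foata2 (run_word d m n) = ?u @ [2]"
    using Suc.IH[OF ex(1)] by simp
  have "foldl foata2_step (?u @ [2]) (replicate (m (Suc d)) 1) =
      replicate (m (Suc d) - 1) 1 @ 2 # ?u @ [1]"
    using foldl_foata2_step_1_2[OF u, of "m (Suc d) - 1"] ex(3) by simp
  moreover have "set (replicate (m (Suc d) - 1) 1 @ 2 # ?u @ [1]) \<subseteq> {1, 2}"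
    using u by auto
  ultimately have "foata2 (run_word (Suc d) m n) =
      (replicate (m (Suc d) - 1) 1 @ 2 # ?u @ [1]) @ replicate (n (Suc d)) 2"
    using IH foldl_foata2_step_2 by (simp only: run_word_Suc foata2_append foldl_append)
  then show ?case by (simp add: tail_part_def)
qed

definition columns :: "'a::linorder list \<Rightarrow> ('a \<times> 'a) list" where
  "columns w = concat (map circuit (dominated_factors w))"

lemma columns_append:
  assumes "set u \<subseteq> {1, 2}"
  shows "columns (u @ (2::nat) # v) = columns u @ columns (2 # v)"
  using assms
proof (induction u rule: dominated_factors.induct)
  case 1
  then show ?case by (simp add: columns_def)
next
  case (2 x xs)
  have x: "x \<le> 2" using "2.prems" by auto
  have *: "takeWhile (\<lambda>y. y < x) (xs @ 2 # v) = takeWhile (\<lambda>y. y < x) xs \<and>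
      dropWhile (\<lambda>y. y < x) (xs @ 2 # v) = dropWhile (\<lambda>y. y < x) xs @ 2 # v" for xs
    by (induction xs) (use x in auto)
  have "set (dropWhile (\<lambda>y. y < x) xs) \<subseteq> {1, 2}"
    using "2.prems" set_dropWhileD by fastforce
  then have "columns (dropWhile (\<lambda>y. y < x) xs @ 2 # v) =
      columns (dropWhile (\<lambda>y. y < x) xs) @ columns (2 # v)"
    by (rule "2.IH")
  then show ?case using *[of xs] by (simp add: columns_def)
qed

lemma columns_replicate: "columns (replicate k x) = replicate k (x, x)"
proof (induction k)
  case (Suc k)
  have "takeWhile (\<lambda>y. y < x) (replicate k x) = []"
    "dropWhile (\<lambda>y. y < x) (replicate k x) = replicate k x"
    by (cases k; simp)+
  with Suc show ?case by (simp add: columns_def circuit_def)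
qed (simp add: columns_def)

lemma columns_block:
  assumes "a > 0" and "b > 0"
  shows "columns (replicate b (2::nat) @ replicate a 1) =
    replicate (b - 1) (2, 2) @ (1, 2) # replicate (a - 1) (1, 1) @ [(2, 1)]"
proof -
  obtain k l where k: "a = Suc k" and l: "b = Suc l"
    using assms by (metis gr0_conv_Suc)
  have "replicate b (2::nat) @ replicate a 1 = replicate l 2 @ 2 # replicate a 1"
    by (simp add: l replicate_app_Cons_same)
  then have "columns (replicate b (2::nat) @ replicate a 1) =
      replicate l (2, 2) @ columns (2 # replicate a 1)"
    using columns_append[of "replicate l 2" "replicate a 1"]
    by (simp add: columns_replicate set_replicate_conv_if)
  moreover have "columns ((2::nat) # replicate a 1) = (1, 2) # replicate k (1, 1) @ [(2, 1)]"
  proof -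
    have t: "takeWhile (\<lambda>y. y < 2) (replicate a (1::nat)) = replicate a 1"
      "dropWhile (\<lambda>y. y < 2) (replicate a (1::nat)) = []"
      by (simp_all add: takeWhile_eq_all_conv dropWhile_eq_Nil_conv)
    have z: "zip (replicate a (1::nat) @ [2]) (2 # replicate a (1::nat)) =
        (1, 2) # zip (replicate k 1 @ [2]) (replicate k 1 @ [1])"
      by (simp add: k replicate_append_same)
    have "circuit ((2::nat) # replicate a 1) = (1, 2) # replicate k (1, 1) @ [(2, 1)]"
      unfolding circuit_def rotate1.simps z by (subst zip_append) simp_all
    then show ?thesis using t by (simp add: columns_def)
  qed
  ultimately show ?thesis by (simp add: k l)
qed

lemma sort_key_two_values:
  "\<forall>p\<in>set xs. fst p = 1 \<or> fst p = (2::nat) \<Longrightarrow>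
     sort_key fst xs = filter (\<lambda>p. fst p = 1) xs @ filter (\<lambda>p. fst p = 2) xs"
proof (induction xs)
  case (Cons x xs)
  have two: "\<forall>p\<in>set A. fst p = 1 \<Longrightarrow> \<forall>p\<in>set B. fst p = 2 \<Longrightarrow> fst x = 2 \<Longrightarrow>
      insort_key fst x (A @ B) = A @ x # B" for A B :: "(nat \<times> 'a) list"
    by (induction A) (auto simp: insort_is_Cons)
  have one: "\<forall>p\<in>set A. fst x \<le> fst p \<Longrightarrow> insort_key fst x A = x # A" for A
    by (simp add: insort_is_Cons)
  let ?A = "filter (\<lambda>p. fst p = 1) xs" and ?B = "filter (\<lambda>p. fst p = 2) xs"
  have IH: "sort_key fst xs = ?A @ ?B" using Cons by simp
  consider "fst x = 1" | "fst x = 2" using Cons.prems by auto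
  then show ?case
  proof cases
    case 1
    then have "insort_key fst x (?A @ ?B) = x # ?A @ ?B" by (intro one) auto
    with 1 IH show ?thesis by simp
  next
    case 2
    then have "insort_key fst x (?A @ ?B) = ?A @ x # ?B" by (intro two) auto
    with 2 IH show ?thesis by simp
  qed
qed simp

theorem foata1_inv_run_word:
  assumes "run_exponents d m n"
  shows "foata1_inv (run_word d m n) =
    replicate (m 0) 1 @ concat (map (\<lambda>i. 2 # replicate (m i - 1) 1) [1..<Suc d])
      @ tail_part d n @ replicate (n d) 2"
proof -
  define W :: "nat \<Rightarrow> nat list" where
    "W d = replicate (m 0) 1
       @ concat (map (\<lambda>j. replicate (n j) 2 @ replicate (m (Suc j)) 1) [0..<d])" for d
  have W: "set (W d) \<subseteq> {1, 2}" for d by (auto simp: W_def)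
  have rw: "run_word d m n = W d @ replicate (n d) 2" for d
    by (induction d) (simp_all add: run_word_0 run_word_Suc W_def)
  have app: "columns (W d @ v) = columns (W d) @ columns v" if "v = [] \<or> hd v = 2" for d v
    using columns_append[OF W, of d] that by (cases v) (auto simp: columns_def)
  define sel :: "nat \<Rightarrow> (nat \<times> nat) list \<Rightarrow> nat list" where
    "sel k xs = map snd (filter (\<lambda>p. fst p = k) xs)" for k xs
  have sel_append: "sel k (xs @ ys) = sel k xs @ sel k ys" for k xs ys by (simp add: sel_def)
  have inv: "(\<forall>p\<in>set (columns (W d)). fst p = 1 \<or> fst p = 2) \<and>
      sel 1 (columns (W d)) =
        replicate (m 0) 1 @ concat (map (\<lambda>i. 2 # replicate (m i - 1) 1) [1..<Suc d]) \<and>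
      sel 2 (columns (W d)) = tail_part d n"
    if "run_exponents d m n" for d
    using that
  proof (induction d)
    case 0
    then show ?case by (simp add: W_def columns_replicate sel_def tail_part_def)
  next
    case (Suc d)
    have pos: "run_exponents d m n" "n d > 0" "m (Suc d) > 0"
      using Suc.prems by (auto simp: run_exponents_def)
    have "W (Suc d) = W d @ replicate (n d) 2 @ replicate (m (Suc d)) 1" by (simp add: W_def)
    moreover have "hd (replicate (n d) 2 @ replicate (m (Suc d)) 1) = (2::nat)"
      using pos(2) by (cases "n d") auto
    ultimately have c: "columns (W (Suc d)) = columns (W d) @ replicate (n d - 1) (2, 2)
        @ (1, 2) # replicate (m (Suc d) - 1) (1, 1) @ [(2, 1)]"
      using app columns_block[OF pos(3,2)] by simp
    show ?case
      using Suc.IH[OF pos(1)] unfolding c by (auto simp: sel_append tail_part_def) (auto simp: sel_def)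
  qed
  have "columns (run_word d m n) = columns (W d) @ replicate (n d) (2, 2)"
    unfolding rw by (subst app) (cases "n d", auto simp: columns_replicate)
  then have "columns (run_word d m n) = columns (W d) @ replicate (n d) (2, 2)"
    and "\<forall>p\<in>set (columns (run_word d m n)). fst p = 1 \<or> fst p = 2"
    using inv[OF assms] by auto
  moreover have "foata1_inv w = sel 1 (columns w) @ sel 2 (columns w)"
    if "\<forall>p\<in>set (columns w). fst p = 1 \<or> fst p = 2" for w
    unfolding foata1_inv_def columns_def[symmetric] sort_key_two_values[OF that]
    by (simp add: sel_def)
  moreover have "sel 1 (replicate k (2, 2)) = []" "sel 2 (replicate k (2, 2)) = replicate k 2" for k
    by (simp_all add: sel_def)
  ultimately show ?thesis using inv[OF assms] by (simp add: sel_append)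
qed

end

theory Submission
  imports Defs
begin

text \<open>Words of \<open>G\<close> are the words \<open>v'2\<^sup>k\<close> with \<open>k \<le> 1\<close>, where \<open>v'\<close> is \<open>v\<close> with every letter
  \<open>2\<close> replaced by \<open>21\<close>. If \<open>v\<close> has \<open>c\<close> letters \<open>2\<close>, then \<open>\<Phi>\<^sub>1\<^sup>-\<^sup>1\<close> and \<open>\<Gamma>\<close> both send this
  word to \<open>v1\<^sup>c2\<^sup>k\<close>, and \<open>\<Phi>\<^sub>2\<close> sends it to the same word with \<open>v\<close> reversed; reversing \<open>v\<close>
  preserves \<open>G\<close>. For words of \<open>H\<close> the closed forms of \<open>\<Phi>\<^sub>1\<^sup>-\<^sup>1\<close> and \<open>\<Phi>\<^sub>2\<close> again differ only by
  the reversal of a prefix, which the symmetry condition makes a palindrome.\<close>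

section \<open>Order and inverse of the standardization\<close>

lemma standardization_mono:
  fixes w :: "'a::linorder list"
  assumes "j < length w" "k < length w" "w ! j < w ! k \<or> w ! j = w ! k \<and> j < k"
  shows "standardization w ! j < standardization w ! k"
proof -
  let ?less = "\<lambda>a. {i. i < length w \<and> w ! i < a}"
  let ?eq = "\<lambda>j. {i. i \<le> j \<and> w ! i = w ! j}"
  \<comment> \<open>The positions counted for \<open>j\<close> are also counted for
    \<open>k\<close>, while \<open>k\<close> itself is counted only for \<open>k\<close>.\<close>
  have "card (?less (w ! j)) + card (?eq j) < card (?less (w ! k)) + card (?eq k)"
    using assms(3)
  proof
    assume lt: "w ! j < w ! k"
    have "card (?less (w ! j)) + card (?eq j) = card (?less (w ! j) \<union> ?eq j)"
      by (rule card_Un_disjoint[symmetric]) auto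
    also have "\<dots> \<le> card (?less (w ! k))"
      by (rule card_mono) (use assms(1) lt in auto)
    also have "card (?eq k) > 0"
      by (subst card_gt_0_iff) auto
    ultimately show ?thesis
      by linarith
  next
    assume eq: "w ! j = w ! k \<and> j < k"
    have "card (?eq j) < card (?eq k)"
    proof (rule psubset_card_mono)
      have "k \<in> ?eq k" "k \<notin> ?eq j"
        using eq by auto
      moreover have "?eq j \<subseteq> ?eq k"
        using eq by auto
      ultimately show "?eq j \<subset> ?eq k"
        by blast
    qed simp
    then show ?thesis
      using eq by simp
  qed
  then show ?thesis
    using assms by (simp add: standardization_def)
qed

lemma standardization_less_iff:
  fixes w :: "'a::linorder list"
  assumes "j < length w" "k < length w"
  shows "standardization w ! j < standardization w ! k \<longleftrightarrow>
    w ! j < w ! k \<or> w ! j = w ! k \<and> j < k"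
  using standardization_mono[of j w k] standardization_mono[of k w j] assms
  by (metis less_asym linorder_less_linear)

lemma standardization_eq_iff:
  fixes w :: "'a::linorder list"
  assumes "j < length w" "k < length w"
  shows "standardization w ! j = standardization w ! k \<longleftrightarrow> j = k"
proof (cases "j = k")
  case False
  then have "(w ! j < w ! k \<or> w ! j = w ! k \<and> j < k) \<or> (w ! k < w ! j \<or> w ! k = w ! j \<and> k < j)"
    by auto
  then show ?thesis
    using False standardization_mono[OF assms] standardization_mono[OF assms(2,1)] by auto
qed simp

lemma length_standardization [simp]: "length (standardization w) = length w"
  by (simp add: standardization_def)

lemma standardization_pos: "j < length w \<Longrightarrow> standardization w ! j > 0"
  by (auto simp: standardization_def card_gt_0_iff)

text \<open>This locates a position in the list of positions carrying a given letter, which is how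
  the standardization gets inverted in \<open>Gamma_filter\<close>.\<close>

lemma nth_filter_upt:
  assumes "P k" "k < n"
  shows "filter P [0..<n] ! card {j. j < k \<and> P j} = k"
proof -
  have split: "[0..<n] = [0..<k] @ k # [Suc k..<n]"
    using assms(2) upt_add_eq_append[of 0 k "n - k"] by (simp add: upt_conv_Cons)
  have "length (filter P [0..<k]) = card {j. j < k \<and> P j}"
    by (subst distinct_card[symmetric]) (auto intro: arg_cong[where f = card])
  then show ?thesis
    using assms(1) unfolding split by (simp add: nth_append)
qed

section \<open>Expansions, their images under Foata's transformations, and the description of
  \<open>G\<close>\<close>

definition expand :: "nat list \<Rightarrow> nat list" where
  "expand v = concat (map (\<lambda>x. if x = 2 then [2, 1] else [1]) v)"

lemma expand_simps [simp]:
  "expand [] = []" "expand (x # v) = (if x = 2 then [2, 1] else [1]) @ expand v"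
  "expand (u @ v) = expand u @ expand v"
  by (auto simp: expand_def)

lemma expand_replicate_1: "expand (replicate a (Suc 0)) = replicate a 1"
  by (induction a) auto

lemma set_expand: "set (expand v) \<subseteq> {1, 2}"
  by (induction v) auto

lemma length_expand_rev: "length (expand (rev v)) = length (expand v)"
  by (induction v) auto

lemma count_list_expand: "count_list (expand v) 2 = count_list v 2"
  by (induction v) auto

text \<open>Every factor \<open>21\<close> or \<open>1\<close> ends in \<open>1\<close>; the
  prepended letter covers the empty word.\<close>

lemma last_Cons_1_expand: "last (1 # expand v) = 1"
  by (induction v rule: rev_induct) auto

text \<open>Reading a factor \<open>21\<close> turns the current word \<open>z\<close> into
  \<open>z2\<close> and then \<open>2z1\<close>; reading a factor \<open>1\<close> turns
  \<open>z\<close> into \<open>1z\<close>. The letters of \<open>v\<close> thus pile up at the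
  front, in reverse order.\<close>

lemma foata2_expand:
  assumes "set v \<subseteq> {1, 2}" "k \<le> 1"
  shows "foata2 (expand v @ replicate k 2) =
    rev v @ replicate (count_list v 2) 1 @ replicate k 2"
proof -
  have *: "foata2 (expand v) = rev v @ replicate (count_list v 2) 1"
    using assms(1)
  proof (induction v rule: rev_induct)
    case Nil
    then show ?case by (simp add: foata2_def)
  next
    case (snoc x v)
    define z where "z = rev v @ replicate (count_list v 2) (1::nat)"
    have IH: "foata2 (expand v) = z" and z: "set z \<subseteq> {1, 2}"
      using snoc by (auto simp: z_def)
    show ?case
    proof (cases "x = 2")
      case True
      have "foata2 (expand (v @ [x])) = foata2_step (foata2_step z 2) 1"
        using True IH by (simp add: foata2_append)
      also have "\<dots> = 2 # z @ [1]"
        using foata2_step_2[OF z] foata2_step_1[OF z, of 2] by simp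
      finally show ?thesis
        using True by (simp add: z_def replicate_append_same)
    next
      case False
      then have x: "x = 1"
        using snoc.prems by auto
      have "foata2_step z 1 = 1 # z"
      proof (cases "z = []")
        case True
        then show ?thesis by (simp add: foata2_step_def)
      next
        case False
        \<comment> \<open>Either \<open>z\<close> has no letter \<open>2\<close> at all, or it ends
          in a nonempty block of \<open>1\<close>s.\<close>
        have "last z = 1"
        proof (cases "count_list v 2")
          case 0
          then have "\<forall>y\<in>set z. y = 1"
            using z by (auto simp: z_def count_list_0_iff)
          then show ?thesis
            using False by auto
        next
          case (Suc c)
          then show ?thesis by (simp add: z_def)
        qed
        then obtain u where "z = u @ [1]"
          using False by (metis append_butlast_last_id)
        then show ?thesis
          using foata2_step_1[of u 1] z by simp
      qed
      then show ?thesis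
        using x IH by (simp add: foata2_append z_def)
    qed
  qed
  have "set (rev v @ replicate (count_list v 2) 1) \<subseteq> {1, 2}"
    using assms(1) by auto
  from foldl_foata2_step_2[OF this] * show ?thesis
    by (simp add: foata2_append)
qed

text \<open>Cutting before the last \<open>2\<close> leaves a block \<open>2\<close> followed by
  \<open>a + 1\<close> letters \<open>1\<close>. Its columns with top letter \<open>1\<close> read
  \<open>2\<close> followed by \<open>a\<close> letters \<open>1\<close>, the corresponding end of
  \<open>v\<close>; its one column with top letter \<open>2\<close> reads \<open>1\<close>.\<close>

lemma columns_expand:
  assumes "set v \<subseteq> {1, 2}"
  shows "(\<forall>p\<in>set (columns (expand v)). fst p = 1 \<or> fst p = 2) \<and>
    map snd (filter (\<lambda>p. fst p = 1) (columns (expand v))) = v \<and>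
    map snd (filter (\<lambda>p. fst p = 2) (columns (expand v))) = replicate (count_list v 2) 1"
  using assms
proof (induction v rule: length_induct)
  case (1 v)
  show ?case
  proof (cases "2 \<in> set v")
    case False
    then have "\<forall>y\<in>set v. y = 1"
      using 1 by auto
    then have v: "v = replicate (length v) 1"
      by (metis replicate_eqI)
    have "columns (expand v) = replicate (length v) (1, 1)"
      by (subst v) (simp add: expand_replicate_1 columns_replicate)
    moreover have "count_list v 2 = 0"
      using False by (simp add: count_list_0_iff)
    ultimately show ?thesis
      using v by simp
  next
    case True
    then obtain u t where v: "v = u @ 2 # t" "2 \<notin> set t"
      using split_list_last[OF True] by blast
    then have "\<forall>y\<in>set t. y = 1"
      using 1 by auto
    then obtain a where t: "t = replicate a 1"
      by (metis replicate_eqI)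
    have "expand v = expand u @ 2 # replicate (Suc a) 1"
      by (simp add: v t expand_replicate_1)
    then have c: "columns (expand v) = columns (expand u) @ (1, 2) # replicate a (1, 1) @ [(2, 1)]"
      using columns_append[OF set_expand, of u "replicate (Suc a) 1"] columns_block[of "Suc a" 1]
      by simp
    have "length u < length v" "set u \<subseteq> {1, 2}"
      using v 1 by auto
    then have "(\<forall>p\<in>set (columns (expand u)). fst p = 1 \<or> fst p = 2) \<and>
      map snd (filter (\<lambda>p. fst p = 1) (columns (expand u))) = u \<and>
      map snd (filter (\<lambda>p. fst p = 2) (columns (expand u))) = replicate (count_list u 2) 1"
      using 1(1) by blast
    moreover have "count_list (replicate a 1) (2::nat) = 0"
      by (simp add: count_list_0_iff)
    ultimately show ?thesis
      unfolding c by (auto simp: v t replicate_append_same)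
  qed
qed

text \<open>The stable sort concatenates the two words of \<open>columns_expand\<close>; a final
  \<open>2\<close> is a circuit by itself, whose column \<open>(2, 2)\<close> stays last.\<close>

lemma foata1_inv_expand:
  assumes "set v \<subseteq> {1, 2}" "k \<le> 1"
  shows "foata1_inv (expand v @ replicate k 2) =
    v @ replicate (count_list v 2) 1 @ replicate k 2"
proof -
  have c: "columns (expand v @ replicate k 2) = columns (expand v) @ replicate k (2, 2)"
    using assms(2) columns_append[OF set_expand, of v "[]"] columns_replicate[of 1 "2::nat"]
    by (cases k) auto
  show ?thesis
    using columns_expand[OF assms(1)]
    unfolding foata1_inv_def columns_def[symmetric] c
    by (subst sort_key_two_values) auto
qed

text \<open>A \<open>2\<close> that is not the last letter is followed by \<open>1\<close> and forms
  a factor \<open>21\<close> with it. Only a final \<open>2\<close> has no partner, hence the extra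
  \<open>replicate k 2\<close>.\<close>

lemma G_iff_expand:
  "w \<in> G n \<longleftrightarrow> length w = n \<and>
    (\<exists>v k. set v \<subseteq> {1, 2} \<and> k \<le> 1 \<and> w = expand v @ replicate k 2)"
proof -
  let ?P = "\<lambda>a b. \<not> (a = 2 \<and> b = (2::nat))"
  have "\<exists>v k. set v \<subseteq> {1, 2} \<and> k \<le> 1 \<and> w = expand v @ replicate k 2"
    if "set w \<subseteq> {1, 2}" "successively ?P w"
    using that
  \<comment> \<open>This rule gives hypotheses for both \<open>w\<close> and \<open>y # w\<close>:
    the former serves when a factor \<open>21\<close> is split off, the latter for a factor
    \<open>1\<close>.\<close>
  proof (induction w rule: induct_list012)
    case 1
    show ?case by (intro exI[of _ "[]"] exI[of _ 0]) simp
  next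
    case (2 x)
    show ?case
    proof (cases "x = 2")
      case True
      then show ?thesis by (intro exI[of _ "[]"] exI[of _ 1]) simp
    next
      case False
      then show ?thesis using 2 by (intro exI[of _ "[1]"] exI[of _ 0]) simp
    qed
  next
    case (3 x y w)
    show ?case
    proof (cases "x = 2")
      case True
      then have "y = 1" "successively ?P w"
        using 3 by (auto simp: successively_Cons)
      then obtain v k where "set v \<subseteq> {1, 2}" "k \<le> 1" "w = expand v @ replicate k 2"
        using 3 by auto
      then show ?thesis
        using True \<open>y = 1\<close> by (intro exI[of _ "2 # v"] exI[of _ k]) simp
    next
      case False
      then obtain v k where "set v \<subseteq> {1, 2}" "k \<le> 1" "y # w = expand v @ replicate k 2"
        using 3 by auto
      then show ?thesis
        using False 3 by (intro exI[of _ "1 # v"] exI[of _ k]) simp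
    qed
  qed
  moreover have "successively ?P (expand v @ replicate k 2)" if "k \<le> 1" for v k
    using that by (induction v) (auto simp: successively_Cons le_Suc_eq)
  moreover have "set (expand v @ replicate k 2) \<subseteq> {1, 2}" for v k
    using set_expand by auto
  moreover have "w \<in> G n \<longleftrightarrow> length w = n \<and> set w \<subseteq> {1, 2} \<and> successively ?P w"
    by (auto simp: G_def successively_conv_nth)
  ultimately show ?thesis
    by blast
qed

section \<open>Steingrimsson's map on standardized words of \<open>G\<close>\<close>

text \<open>The involution exchanging the two positions of every factor \<open>21\<close>: on words of \<open>G\<close>,
  Steingrimsson's map sends the argument \<open>\<pi>\<^sub>j\<close>, \<open>j = swap21 w k\<close>, to \<open>\<pi>\<^sub>k\<close>.\<close>

definition swap21 :: "nat list \<Rightarrow> nat \<Rightarrow> nat" where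
  "swap21 w k =
     (if w ! k = 2 \<and> Suc k < length w then Suc k
      else if w ! k = 1 \<and> k > 0 \<and> w ! (k - 1) = 2 then k - 1 else k)"

lemma G_nth:
  assumes "w \<in> G n"
  shows "length w = n" "i < n \<Longrightarrow> w ! i = 1 \<or> w ! i = 2"
    "Suc i < n \<Longrightarrow> w ! i = 2 \<Longrightarrow> w ! Suc i = 1"
proof -
  show l: "length w = n"
    using assms by (simp add: G_def)
  show b: "w ! i = 1 \<or> w ! i = 2" if "i < n" for i
    using assms that subsetD[OF _ nth_mem[of i w], of "{1, 2}"] by (auto simp: G_def)
  show "Suc i < n \<Longrightarrow> w ! i = 2 \<Longrightarrow> w ! Suc i = 1"
    using assms b[of "Suc i"] by (auto simp: G_def)
qed

lemma swap21_involution: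
  assumes "w \<in> G n" "k < n"
  shows "swap21 w k < n" "swap21 w (swap21 w k) = k"
  using G_nth[OF assms(1)] assms(2) by (auto simp: swap21_def)

text \<open>Rule (1) applies exactly to a \<open>2\<close> that is not final and leads to the next
  position. Under rule (2) the nearest smaller value is the immediate predecessor, unless a
  \<open>2\<close> precedes a \<open>1\<close>; then that \<open>2\<close> is skipped and the
  argument is its value.\<close>

lemma phi_arg_standardization:
  assumes w: "w \<in> G n" and k: "k < n"
  shows "phi_arg (standardization w) (Suc k) = standardization w ! swap21 w k"
proof -
  let ?p = "standardization w"
  note G = G_nth[OF w]
  have at: "pi_at ?p (Suc j) = ?p ! j" for j
    by (simp add: pi_at_def)
  have at0: "pi_at ?p 0 = 0"
    by (simp add: pi_at_def)
  have less: "?p ! i < ?p ! j \<longleftrightarrow> w ! i < w ! j \<or> w ! i = w ! j \<and> i < j" if "i < n" "j < n" for i j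
    using standardization_less_iff[of i w j] that G(1) by simp
  let ?E = "\<exists>m. Suc k < m \<and> m \<le> length ?p \<and> pi_at ?p m < pi_at ?p (Suc k)"
  have E: "?E \<longleftrightarrow> w ! k = 2 \<and> Suc k < n"
  proof
    assume ?E
    then obtain m where m: "Suc k < m" "m \<le> n" "pi_at ?p m < pi_at ?p (Suc k)"
      using G(1) by auto
    then obtain i where i: "m = Suc i"
      by (cases m) auto
    then have "w ! i < w ! k"
      using m less[of i k] k by (auto simp: at)
    then show "w ! k = 2 \<and> Suc k < n"
      using G(2)[of i] G(2)[of k] i m by auto
  next
    assume a: "w ! k = 2 \<and> Suc k < n"
    then have "w ! Suc k = 1"
      using G(3) by blast
    then have "?p ! Suc k < ?p ! k"
      using a less[of "Suc k" k] k by simp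
    then show ?E
      using a G(1) by (intro exI[of _ "Suc (Suc k)"]) (simp add: at)
  qed
  show ?thesis
  proof (cases ?E)
    case True
    then show ?thesis
      using E G(1) True unfolding phi_arg_def by (simp only: if_True) (simp add: at swap21_def)
  next
    case False
    let ?J = "{j. j < Suc k \<and> pi_at ?p j < pi_at ?p (Suc k)}"
    have "\<not> (w ! k = 2 \<and> Suc k < length w)"
      using False unfolding E G(1) .
    then have sw: "swap21 w k = (if w ! k = 1 \<and> k > 0 \<and> w ! (k - 1) = 2 then k - 1 else k)"
      unfolding swap21_def by (rule if_not_P)
    \<comment> \<open>\<open>Max ?J\<close> is an index counted from 1 and \<open>swap21 w k\<close>
      a position counted from 0; the \<open>+ 1\<close> in \<open>phi_arg\<close> makes up for
      this.\<close>
    have "Max ?J = swap21 w k"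
    proof (rule Max_eqI)
      show "finite ?J" by simp
    next
      have "pi_at ?p (swap21 w k) < ?p ! k"
      proof (cases "swap21 w k")
        \<comment> \<open>The index 0 stands for the conventional value 0, which is below every
          standardized value.\<close>
        case 0
        then show ?thesis
          using k G(1) standardization_pos[of k w] by (simp add: at0)
      next
        case (Suc i)
        then have i: "i < k" "i < n"
          using k by (auto simp: sw split: if_splits)
        have "w ! i \<le> w ! k"
        proof (rule ccontr)
          assume "\<not> w ! i \<le> w ! k"
          then have a: "w ! i = 2" "w ! k = 1"
            using G(2)[of i] G(2)[of k] i k by auto
          then have "w ! Suc i = 1"
            using G(3)[of i] i k by simp
          then show False
            using a Suc i k by (auto simp: sw split: if_splits)
        qed
        then show ?thesis
          using less[of i k] i k Suc by (auto simp: at)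
      qed
      then show "swap21 w k \<in> ?J"
        by (auto simp: at sw)
    next
      fix j assume j: "j \<in> ?J"
      show "j \<le> swap21 w k"
      proof (rule ccontr)
        assume "\<not> j \<le> swap21 w k"
        \<comment> \<open>Since \<open>j \<le> k\<close>, this happens only when a factor
          \<open>21\<close> ends at position \<open>k\<close>; then \<open>j = k\<close> is the
          index of its \<open>2\<close>, whose value is too large.\<close>
        then have "w ! k = 1" "k > 0" "w ! (k - 1) = 2" "j = k"
          using j by (auto simp: sw split: if_splits)
        then show False
          using j less[of "k - 1" k] k at[of "k - 1"] by (simp add: at)
      qed
    qed
    then show ?thesis
      unfolding phi_arg_def if_not_P[OF False] by (simp only: at Suc_eq_plus1[symmetric])
  qed
qed

text \<open>As \<open>swap21\<close> is an involution, \<open>phi_arg\<close> takes the value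
  \<open>Suc i\<close> only at position \<open>swap21 w k\<close>. The value of \<open>phi\<close>
  there is the standardization at that position, so \<open>Gamma\<close> reads off its
  letter.\<close>

lemma Gamma_nth:
  assumes w: "w \<in> G n" and k: "k < n" and i: "i < n" "standardization w ! k = Suc i"
  shows "Gamma w ! i = w ! swap21 w k"
proof -
  let ?p = "standardization w"
  have l: "length w = n"
    using G_nth(1)[OF w] .
  have inj: "?p ! a = ?p ! b \<longleftrightarrow> a = b" if "a < n" "b < n" for a b
    using standardization_eq_iff that l by blast
  have "(THE K. 1 \<le> K \<and> K \<le> length ?p \<and> phi_arg ?p K = Suc i) = Suc (swap21 w k)"
  proof (rule the_equality)
    show "1 \<le> Suc (swap21 w k) \<and> Suc (swap21 w k) \<le> length ?p \<and>
        phi_arg ?p (Suc (swap21 w k)) = Suc i"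
      using phi_arg_standardization[OF w, of "swap21 w k"] swap21_involution[OF w k] l i by simp
  next
    fix K assume K: "1 \<le> K \<and> K \<le> length ?p \<and> phi_arg ?p K = Suc i"
    then obtain a where a: "K = Suc a" "a < n"
      using l by (cases K) auto
    then have "?p ! swap21 w a = ?p ! k"
      using K phi_arg_standardization[OF w, of a] i by simp
    then show "K = Suc (swap21 w k)"
      using inj swap21_involution[OF w] a k by metis
  qed
  then have "phi ?p ! i = ?p ! swap21 w k"
    using i l by (simp add: phi_def pi_at_def del: upt_Suc)
  moreover have "(THE j. j < n \<and> ?p ! j = ?p ! swap21 w k) = swap21 w k"
    by (rule the_equality) (use inj swap21_involution[OF w k] in auto)
  ultimately show ?thesis
    using i l by (simp add: Gamma_def)
qed

text \<open>Listing the positions of \<open>1\<close> and then those of \<open>2\<close> inverts the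
  standardization, so \<open>Gamma_nth\<close> applies entry by entry.\<close>

lemma Gamma_filter:
  assumes w: "w \<in> G n"
  shows "Gamma w = map (\<lambda>k. w ! swap21 w k)
    (filter (\<lambda>k. w ! k = 1) [0..<n] @ filter (\<lambda>k. w ! k = 2) [0..<n])"
    (is "_ = map ?g (?A @ ?B)")
proof -
  let ?p = "standardization w"
  note G = G_nth[OF w]
  have len: "length ?A = card {j. j < n \<and> w ! j = 1}"
    by (subst distinct_card[symmetric]) (auto intro: arg_cong[where f = card])
  have std: "?p ! k > 0 \<and> (?A @ ?B) ! (?p ! k - 1) = k" if k: "k < n" for k
  proof -
    have eq: "card {j. j \<le> k \<and> w ! j = w ! k} = Suc (card {j. j < k \<and> w ! j = w ! k})"
    proof -
      have "{j. j \<le> k \<and> w ! j = w ! k} = insert k {j. j < k \<and> w ! j = w ! k}"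
        by auto
      then show ?thesis by simp
    qed
    have p: "?p ! k = Suc (card {j. j < n \<and> w ! j < w ! k} + card {j. j < k \<and> w ! j = w ! k})"
      using k G(1) eq by (simp add: standardization_def)
    have "(?A @ ?B) ! (card {j. j < n \<and> w ! j < w ! k} + card {j. j < k \<and> w ! j = w ! k}) = k"
    proof (cases "w ! k = 1")
      case True
      have "{j. j < n \<and> w ! j < w ! k} = {}"
        using True G(2) by fastforce
      then have "card {j. j < n \<and> w ! j < w ! k} = 0"
        by (simp only: card.empty)
      moreover have "card {j. j < k \<and> w ! j = 1} < length ?A"
        unfolding len by (rule psubset_card_mono) (use k True in auto)
      ultimately show ?thesis
        using nth_filter_upt[of "\<lambda>k. w ! k = 1" k n] True k by (simp only: add_0) (simp add: nth_append)
    next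
      case False
      then have 2: "w ! k = 2"
        using G(2) k by blast
      have "{j. j < n \<and> w ! j < w ! k} = {j. j < n \<and> w ! j = 1}"
        using 2 G(2) by fastforce
      then show ?thesis
        using nth_filter_upt[of "\<lambda>k. w ! k = 2" k n] 2 k len by (simp only:) (simp add: nth_append)
    qed
    then show ?thesis
      using p by simp
  qed
  have dist: "distinct (?A @ ?B)"
    by auto
  have set: "set (?A @ ?B) = {..<n}"
    using G(2) by auto
  have L: "length (?A @ ?B) = n"
    using distinct_card[OF dist] set by simp
  show ?thesis
  proof (rule nth_equalityI)
    show "length (Gamma w) = length (map ?g (?A @ ?B))"
      using L G(1) by (simp add: Gamma_def)
  next
    fix i assume "i < length (Gamma w)"
    then have i: "i < n"
      using G(1) by (simp add: Gamma_def)
    define k where "k = (?A @ ?B) ! i"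
    have k: "k < n"
      using set nth_mem[of i "?A @ ?B"] i L k_def by auto
    \<comment> \<open>This keeps the index \<open>?p ! k - 1\<close> inside the list, so that
      distinctness identifies it with \<open>i\<close>.\<close>
    have bound: "?p ! k \<le> n"
    proof -
      have "card {j. j < n \<and> w ! j < w ! k} + card {j. j \<le> k \<and> w ! j = w ! k}
          = card ({j. j < n \<and> w ! j < w ! k} \<union> {j. j \<le> k \<and> w ! j = w ! k})"
        by (rule card_Un_disjoint[symmetric]) auto
      also have "\<dots> \<le> card {..<n}"
        by (rule card_mono) (use k in auto)
      finally show ?thesis
        using k G(1) by (simp add: standardization_def)
    qed
    have "?p ! k - 1 = i"
      using std[OF k] bound i L k_def nth_eq_iff_index_eq[OF dist, of "?p ! k - 1" i] by auto
    then have "?p ! k = Suc i"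
      using std[OF k] by linarith
    then show "Gamma w ! i = map ?g (?A @ ?B) ! i"
      using Gamma_nth[OF w k i] i nth_map[of i "?A @ ?B" ?g] L k_def by metis
  qed
qed

section \<open>The images of expansions under \<open>Gamma\<close>\<close>

lemma filter_nth_snoc:
  "filter (\<lambda>k. (u @ [x]) ! k = c) [0..<length (u @ [x])] =
     filter (\<lambda>k. u ! k = c) [0..<length u] @ (if x = c then [length u] else [])"
  by (auto simp: nth_append intro!: filter_cong)

text \<open>Prepending \<open>1\<close> shifts the indices by one, so that \<open>k\<close> selects
  the letter before position \<open>k\<close>; an initial \<open>1\<close> gets \<open>1\<close> as
  predecessor.\<close>

definition predecessors_of_1 :: "nat list \<Rightarrow> nat list" where
  "predecessors_of_1 w = map ((!) (1 # w)) (filter (\<lambda>k. w ! k = 1) [0..<length w])"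

lemma predecessors_of_1_snoc:
  "predecessors_of_1 (u @ [x]) = predecessors_of_1 u @ (if x = 1 then [last (1 # u)] else [])"
proof -
  have "(1 # u @ [x]) ! k = (1 # u) ! k" if "k \<le> length u" for k
    using that nth_append[of "1 # u" "[x]" k] by simp
  moreover have "(1 # u) ! length u = last (1 # u)"
    by (simp add: last_conv_nth)
  ultimately show ?thesis
    unfolding predecessors_of_1_def filter_nth_snoc by (auto simp del: last.simps)
qed

text \<open>Each letter of \<open>v\<close> yields exactly one \<open>1\<close>, preceded by
  \<open>2\<close> in a factor \<open>21\<close> and otherwise by the closing \<open>1\<close> of
  the previous factor or the prepended one.\<close>

lemma predecessors_of_1_expand:
  assumes "set v \<subseteq> {1, 2}"
  shows "predecessors_of_1 (expand v) = v"
  using assms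
proof (induction v rule: rev_induct)
  case Nil
  then show ?case by (simp add: predecessors_of_1_def)
next
  case (snoc x v)
  then show ?case
    using predecessors_of_1_snoc[of "expand v" x] predecessors_of_1_snoc[of "expand v" 2]
      predecessors_of_1_snoc[of "expand v @ [2]" 1] last_Cons_1_expand[of v]
    by (cases "x = 2") auto
qed

lemma length_filter_nth: "length (filter (\<lambda>k. u ! k = c) [0..<length u]) = count_list u c"
proof (induction u rule: rev_induct)
  case (snoc x u)
  then show ?case unfolding filter_nth_snoc by simp
qed simp

text \<open>At a \<open>1\<close>, \<open>swap21\<close> selects a letter equal to the preceding
  one, which spells \<open>v\<close>; at a \<open>2\<close> of the expansion it selects the
  \<open>1\<close> that follows; a final \<open>2\<close> is fixed.\<close>

lemma Gamma_expand:
  assumes v: "set v \<subseteq> {1, 2}" and k: "k \<le> 1"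
  shows "Gamma (expand v @ replicate k 2) = v @ replicate (count_list v 2) 1 @ replicate k 2"
proof -
  define u where "u = expand v"
  define w where "w = u @ replicate k 2"
  have w: "w \<in> G (length w)"
    using v k by (auto simp: G_iff_expand w_def u_def)
  note G = G_nth[OF w]
  have k': "k = 0 \<or> k = 1"
    using k by auto
  have "map (\<lambda>j. w ! swap21 w j) (filter (\<lambda>j. w ! j = 1) [0..<length w]) = predecessors_of_1 w"
    unfolding predecessors_of_1_def
  proof (rule map_cong[OF refl])
    fix j assume "j \<in> set (filter (\<lambda>j. w ! j = 1) [0..<length w])"
    then have "j < length w" "w ! j = 1"
      by auto
    then show "w ! swap21 w j = (1 # w) ! j"
      using G(2)[of "j - 1"] by (cases j) (auto simp: swap21_def)
  qed
  also have "\<dots> = v"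
    using k' predecessors_of_1_snoc[of u 2] predecessors_of_1_expand[OF v] by (auto simp: w_def u_def)
  finally have 1: "map (\<lambda>j. w ! swap21 w j) (filter (\<lambda>j. w ! j = 1) [0..<length w]) = v" .
  \<comment> \<open>An expansion does not end in \<open>2\<close>, so each \<open>2\<close> in
    \<open>u\<close> has a successor within \<open>u\<close>.\<close>
  have last_u: "u ! j = 1" if "Suc j = length u" for j
    using that[symmetric] last_Cons_1_expand[of v] u_def
    by (auto simp: last_conv_nth split: if_splits)
  have "w ! swap21 w j = 1" if "j < length u" "u ! j = 2" for j
  proof -
    have j: "w ! j = 2" "Suc j < length w"
      using that last_u[of j] by (cases "Suc j = length u"; simp add: w_def nth_append)+
    then show ?thesis
      using G(3)[of j] by (simp add: swap21_def)
  qed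
  then have "map (\<lambda>j. w ! swap21 w j) (filter (\<lambda>j. u ! j = 2) [0..<length u]) =
      replicate (count_list v 2) 1"
    using count_list_expand[of v]
    by (auto simp: length_filter_nth u_def map_replicate_const intro!: replicate_eqI)
  moreover have "w ! swap21 w (length u) = 2" if "k = 1"
    using that by (simp add: swap21_def w_def nth_append)
  ultimately have 2: "map (\<lambda>j. w ! swap21 w j) (filter (\<lambda>j. w ! j = 2) [0..<length w]) =
      replicate (count_list v 2) 1 @ replicate k 2"
    using k' filter_nth_snoc[of u 2 2] by (auto simp: w_def)
  show ?thesis
    using Gamma_filter[OF w] 1 2 by (simp add: w_def u_def)
qed

section \<open>Agreement of the closed forms on \<open>H\<close>\<close>

lemma foata1_inv_eq_foata2_on_H:
  assumes "w \<in> H"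
  shows "foata1_inv w = foata2 w"
proof -
  obtain d m n where w: "w = run_word d m n" and ex: "run_exponents d m n"
    and md: "int (m 0) = int (m d) - 1" and sym: "\<forall>i. 1 \<le> i \<and> i \<le> d - 1 \<longrightarrow> m i = m (d - i)"
    using assms by (auto simp: H_def)
  \<comment> \<open>These are the lengths of the runs of \<open>1\<close> between the first
    \<open>d\<close> letters \<open>2\<close> of the image; membership in \<open>H\<close> makes
    this sequence a palindrome.\<close>
  define e where "e i = (if i = 0 then m 0 else m i - 1)" for i
  have "d > 0"
    using md by (cases d) auto
  have e_sym: "e i = e (d - i)" if "i \<le> d" for i
  proof -
    consider "i = 0" | "i = d" | "1 \<le> i \<and> i \<le> d - 1"
      using \<open>i \<le> d\<close> by linarith
    then show ?thesis
    proof cases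
      case 3
      then have "m i = m (d - i)"
        using sym by blast
      then show ?thesis
        using 3 by (auto simp: e_def)
    qed (use md \<open>d > 0\<close> in \<open>auto simp: e_def\<close>)
  qed
  \<comment> \<open>Each separating \<open>2\<close> is regrouped with the run before it instead of
    the run after it, as in the closed form of \<open>foata2\<close>.\<close>
  have shift: "replicate (e 0) 1 @ concat (map (\<lambda>i. 2 # replicate (e i) 1) [1..<Suc l]) =
      concat (map (\<lambda>i. replicate (e i) 1 @ [2]) [0..<l]) @ replicate (e l) (1::nat)" for l
    by (induction l) auto
  have rev: "rev [1..<Suc d] = map (\<lambda>i. d - i) [0..<d]"
    by (rule nth_equalityI) (auto simp: rev_nth simp del: upt_Suc)
  have "replicate (m 0) (1::nat) @ concat (map (\<lambda>i. 2 # replicate (m i - 1) 1) [1..<Suc d]) =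
      replicate (e 0) 1 @ concat (map (\<lambda>i. 2 # replicate (e i) 1) [1..<Suc d])"
    by (auto simp: e_def intro!: arg_cong[where f = concat] simp del: upt_Suc)
  also have "\<dots> = concat (map (\<lambda>i. replicate (e (d - i)) 1 @ [2]) [0..<d]) @ replicate (e d) 1"
    unfolding shift by (intro arg_cong2[where f = "(@)"] arg_cong[where f = concat] map_cong refl)
      (auto simp: e_sym[symmetric])
  also have "\<dots> = concat (map (\<lambda>i. replicate (e i) 1 @ [2]) (rev [1..<Suc d])) @ replicate (m 0) 1"
    using e_sym[of 0] unfolding rev by (simp add: comp_def e_def)
  also have "\<dots> = concat (map (\<lambda>i. replicate (m i - 1) 1 @ [2]) (rev [1..<Suc d])) @
      replicate (m 0) 1"
    by (auto simp: e_def intro!: arg_cong[where f = concat] simp del: upt_Suc)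
  finally show ?thesis
    unfolding w foata1_inv_run_word[OF ex] foata2_run_word[OF ex] by (simp only: append.assoc[symmetric])
qed

theorem theorem4p1:
  fixes n :: nat
  assumes "n > 0"
  shows "foata2 ` G n = foata1_inv ` G n \<and>
         foata1_inv ` G n = Gamma ` G n \<and>
         (\<forall>w\<in>H. foata1_inv w = foata2 w)"
proof (intro conjI ballI)
  \<comment> \<open>The word \<open>w'\<close> comes from reversing \<open>v\<close>; being
    symmetric in the two maps, the claim gives both inclusions.\<close>
  have reflect: "\<exists>w'\<in>G n. foata1_inv w' = foata2 w \<and> foata2 w' = foata1_inv w" if "w \<in> G n" for w
  proof -
    obtain v k where v: "set v \<subseteq> {1, 2}" "k \<le> 1" and w: "w = expand v @ replicate k 2"
      and len: "length w = n"
      using \<open>w \<in> G n\<close> unfolding G_iff_expand by blast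
    have v': "set (rev v) \<subseteq> {1, 2}"
      using v by simp
    have "count_list (rev v) 2 = count_list v 2"
      by (induction v) auto
    moreover have "expand (rev v) @ replicate k 2 \<in> G n"
      using v(2) v' w len length_expand_rev[of v] unfolding G_iff_expand
      by (intro conjI exI[of _ "rev v"] exI[of _ k]) simp_all
    ultimately show ?thesis
      using foata1_inv_expand[OF v] foata2_expand[OF v] foata1_inv_expand[OF v' v(2)]
        foata2_expand[OF v' v(2)] w by (intro bexI[of _ "expand (rev v) @ replicate k 2"]) auto
  qed
  show "foata2 ` G n = foata1_inv ` G n"
  proof
    show "foata2 ` G n \<subseteq> foata1_inv ` G n"
      using reflect by (metis (no_types, lifting) image_eqI image_subsetI)
    show "foata1_inv ` G n \<subseteq> foata2 ` G n"
      using reflect by (metis (no_types, lifting) image_eqI image_subsetI)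
  qed
  show "foata1_inv ` G n = Gamma ` G n"
    by (rule image_cong) (auto simp: G_iff_expand foata1_inv_expand Gamma_expand)
  show "foata1_inv w = foata2 w" if "w \<in> H" for w
    using foata1_inv_eq_foata2_on_H[OF that] .
qed

end
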